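(* Let $A$ be a finite alphabet and let $f : A^{\mathbb{Z}} \to A^{\mathbb{Z}}$ be a cellular automaton. If the restriction of $f$ to its generic limit set $\tilde\omega(f)$ is a shift map (that is, $f|_{\tilde\omega(f)} = \sigma^n|_{\tilde\omega(f)}$ for some $n \in \mathbb{Z}$), then $\tilde\omega(f)$ is a chain transitive subshift.
   Context: $\mathbb{N}$ contains $0$. For a finite alphabet $A$, the full shift $A^{\mathbb{Z}}$ has the product topology (a compact metrizable space), and the left shift $\sigma$ is given by $\sigma(x)_i = x_{i+1}$. A cellular automaton (CA) on $A^{\mathbb{Z}}$ is a continuous map $f : A^{\mathbb{Z}} \to A^{\mathbb{Z}}$ commuting with $\sigma$. A subset of a topological space is comeager if it contains an intersection of countably many dense open sets. For $x \in A^{\mathbb{Z}}$, $\omega(x)$ is the set of limit points (limits of subsequences) of the forward orbit $(f^t(x))_{t\in\mathbb{N}}$. For $Y \subset A^{\mathbb{Z}}$, the realm of attraction is $\mathfrak{D}(Y) = \{x \in A^{\mathbb{Z}} \mid \omega(x) \subset Y\}$. The generic limit set $\tilde\omega(f)$ is the intersection of all closed sets $C \subset A^{\mathbb{Z}}$ such that $\mathfrak{D}(C)$ is comeager (it is a nonempty $f$-invariant subshift and has a comeager realm). A subshift is a closed $\sigma$-invariant set $X \subset A^{\mathbb{Z}}$. For $w \in A^*$, $[w] = \{x \in A^{\mathbb{Z}} \mid x_{[0,|w|)} = w\}$. The language of $X$ is $\mathcal{L}(X) = \{w \in A^* \mid [w] \cap X \neq \emptyset\}$, and $\mathcal{L}_n(X)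 = \mathcal{L}(X) \cap A^n$. The order-$n$ SFT approximation $\mathcal{S}_n(X) \subset A^{\mathbb{Z}}$ is the set of all $x \in A^{\mathbb{Z}}$ in which no word of $A^n \setminus \mathcal{L}_n(X)$ occurs. A subshift $X$ is transitive if for all $u, v \in \mathcal{L}(X)$ there exists $w \in A^*$ with $uwv \in \mathcal{L}(X)$. A subshift $X$ is chain transitive if $\mathcal{S}_n(X)$ is transitive for each $n$. *)

theory Defs
  imports "HOL-Analysis.Analysis"
begin

text \<open>
  The alphabet is a type of class finite and discrete_topology (the second class only says that
  every set of letters is open), so the library topology on the function type is the product
  topology of the full shift.
\<close>

type_synonym 'a config = "int \<Rightarrow> 'a"

definition shift :: "'a config \<Rightarrow> 'a config" where
  "shift x = (\<lambda>i. x (i + 1))"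

definition shift_power :: "int \<Rightarrow> 'a config \<Rightarrow> 'a config" where
  "shift_power n = (if n \<ge> 0 then shift ^^ nat n else inv shift ^^ nat (- n))"

lemma inv_shift: "inv shift x = (\<lambda>i. x (i - 1))"
  by (rule inv_f_eq) (auto simp: inj_def shift_def fun_eq_iff dest: spec[of _ "_ - 1"])

lemma shift_power_apply: "shift_power n x i = x (i + n)"
proof -
  have pos: "(shift ^^ k) x i = x (i + int k)" for k i
    by (induction k arbitrary: i) (simp_all add: shift_def add.assoc)
  have neg: "(inv shift ^^ k) x i = x (i - int k)" for k i
    by (induction k arbitrary: i) (simp_all add: inv_shift algebra_simps)
  show ?thesis
    by (simp add: shift_power_def pos neg)
qed

definition cellular_automaton ::
    "('a::{finite,discrete_topology} config \<Rightarrow> 'a config) \<Rightarrow> bool" where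
  "cellular_automaton f \<longleftrightarrow> continuous_on UNIV f \<and> f \<circ> shift = shift \<circ> f"

definition comeager :: "'b::topological_space set \<Rightarrow> bool" where
  "comeager S \<longleftrightarrow>
     (\<exists>\<G>. countable \<G> \<and> (\<forall>U\<in>\<G>. open U \<and> closure U = UNIV) \<and> \<Inter>\<G> \<subseteq> S)"

definition omega_limit :: "('b::topological_space \<Rightarrow> 'b) \<Rightarrow> 'b \<Rightarrow> 'b set" where
  "omega_limit f x =
     {y. \<exists>r. strict_mono (r :: nat \<Rightarrow> nat) \<and> (\<lambda>k. (f ^^ r k) x) \<longlonglongrightarrow> y}"

definition realm :: "('b::topological_space \<Rightarrow> 'b) \<Rightarrow> 'b set \<Rightarrow> 'b set" where
  "realm f Y = {x. omega_limit f x \<subseteq> Y}"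

definition generic_limit_set :: "('b::topological_space \<Rightarrow> 'b) \<Rightarrow> 'b set" where
  "generic_limit_set f = \<Inter>{C. closed C \<and> comeager (realm f C)}"

text \<open>Invariance under the shift is equality of the set with its image, not mere inclusion.\<close>

definition subshift :: "'a::{finite,discrete_topology} config set \<Rightarrow> bool" where
  "subshift X \<longleftrightarrow> closed X \<and> shift ` X = X"

definition factor_at :: "'a config \<Rightarrow> int \<Rightarrow> nat \<Rightarrow> 'a list" where
  "factor_at x i n = map (\<lambda>k. x (i + int k)) [0..<n]"

definition occurs_in :: "'a list \<Rightarrow> 'a config \<Rightarrow> bool" where
  "occurs_in w x \<longleftrightarrow> (\<exists>i. factor_at x i (length w) = w)"

definition cylinder :: "'a list \<Rightarrow> 'a config set" where
  "cylinder w = {x. factor_at x 0 (length w) = w}"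

definition language :: "'a config set \<Rightarrow> 'a list set" where
  "language X = {w. cylinder w \<inter> X \<noteq> {}}"

definition language_n :: "nat \<Rightarrow> 'a config set \<Rightarrow> 'a list set" where
  "language_n n X = language X \<inter> {w. length w = n}"

definition sft_approx :: "nat \<Rightarrow> 'a config set \<Rightarrow> 'a config set" where
  "sft_approx n X = {x. \<forall>w \<in> {w. length w = n} - language_n n X. \<not> occurs_in w x}"

definition transitive_subshift :: "'a::{finite,discrete_topology} config set \<Rightarrow> bool" where
  "transitive_subshift X \<longleftrightarrow>
     subshift X \<and> (\<forall>u\<in>language X. \<forall>v\<in>language X. \<exists>w. u @ w @ v \<in> language X)"

definition chain_transitive_subshift :: "'a::{finite,discrete_topology} config set \<Rightarrow> bool" where
  "chain_transitive_subshift X \<longleftrightarrow> subshift X \<and> (\<forall>n. transitive_subshift (sft_approx n X))"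

end

theory Submission
  imports Defs
begin

text \<open>
  Let \<open>X\<close> be the generic limit set, on which \<open>f\<close> is the shift by \<open>k\<close>, and let \<open>a\<close>, \<open>b\<close> be words of
  length \<open>n\<close> in its language. There is a nonempty open set \<open>U\<close> such that the orbit of a generic
  point of \<open>U\<close> shows \<open>a\<close> at the origin infinitely often, and a similar set \<open>V\<close> for \<open>b\<close>. By Baire,
  for some \<open>m \<ge> 0\<close> a single point \<open>x\<close> shows \<open>a\<close> at \<open>0\<close> and \<open>b\<close> at \<open>m\<close> infinitely often, while a
  large central window of its orbit eventually agrees with points of \<open>X\<close> and is shifted by \<open>k\<close>
  at each step. Gluing overlapping windows along the orbit, in the direction of time given by
  the sign of \<open>k\<close>, yields a point of the order-\<open>n\<close> approximation in which \<open>b\<close> follows \<open>a\<close>.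
\<close>

section \<open>Comeager sets\<close>

lemma dense_iff_meets_open:
  "closure S = UNIV \<longleftrightarrow> (\<forall>U. open U \<longrightarrow> U \<noteq> {} \<longrightarrow> U \<inter> S \<noteq> {})"
proof
  assume "closure S = UNIV"
  then show "\<forall>U. open U \<longrightarrow> U \<noteq> {} \<longrightarrow> U \<inter> S \<noteq> {}"
    by (metis open_Int_closure_eq_empty inf_top_right)
next
  assume "\<forall>U. open U \<longrightarrow> U \<noteq> {} \<longrightarrow> U \<inter> S \<noteq> {}"
  then have "- closure S = {}"
    by (metis open_Compl closed_closure closure_subset disjoint_eq_subset_Compl inf_commute
        compl_le_compl_iff)
  then show "closure S = UNIV" by auto
qed

lemma comeager_mono: "comeager S \<Longrightarrow> S \<subseteq> T \<Longrightarrow> comeager T"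
  unfolding comeager_def by (meson subset_trans)

lemma comeager_INT:
  assumes "countable I" "\<And>i. i \<in> I \<Longrightarrow> comeager (S i)"
  shows "comeager (\<Inter>i\<in>I. S i)"
proof -
  obtain G where G: "\<And>i. i \<in> I \<Longrightarrow>
      countable (G i) \<and> (\<forall>U\<in>G i. open U \<and> closure U = UNIV) \<and> \<Inter>(G i) \<subseteq> S i"
    using assms(2) unfolding comeager_def by metis
  show ?thesis
    unfolding comeager_def
  proof (intro exI[of _ "\<Union>i\<in>I. G i"] conjI)
    show "countable (\<Union>i\<in>I. G i)" using assms(1) G by auto
    show "\<forall>U\<in>\<Union>i\<in>I. G i. open U \<and> closure U = UNIV" using G by blast
    show "\<Inter> (\<Union>i\<in>I. G i) \<subseteq> (\<Inter>i\<in>I. S i)"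
    proof (rule INF_greatest)
      fix i assume i: "i \<in> I"
      then have "\<Inter> (\<Union>i\<in>I. G i) \<subseteq> \<Inter>(G i)" by (intro Inter_anti_mono) auto
      also have "\<dots> \<subseteq> S i" using G[OF i] by simp
      finally show "\<Inter> (\<Union>i\<in>I. G i) \<subseteq> S i" .
    qed
  qed
qed

lemma comeager_Int:
  assumes "comeager S" "comeager T"
  shows "comeager (S \<inter> T)"
proof -
  \<comment> \<open>The pair is indexed by the Booleans, so the countable intersection
    applies.\<close>
  have "comeager (\<Inter>b\<in>UNIV. if b then S else T)"
    by (rule comeager_INT) (simp_all add: assms)
  then show ?thesis by (simp add: UNIV_bool Int_commute)
qed

lemma comeager_open_dense: "open U \<Longrightarrow> closure U = UNIV \<Longrightarrow> comeager U"
  unfolding comeager_def by (rule exI[of _ "{U}"]) auto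

text \<open>A homeomorphism pulls dense open sets back to dense open sets: a nonempty open
  \<open>V\<close> meets \<open>h -\<close> U\<open>because its image\<close>g -\<open>V\<close>
  under \<open>h\<close> is open and meets \<open>U\<close>. It will be applied to powers of the
  shift.\<close>

lemma comeager_vimage:
  fixes h g :: "'b::topological_space \<Rightarrow> 'b"
  assumes "comeager S" and h: "continuous_on UNIV h" and g: "continuous_on UNIV g"
    and hg: "\<And>x. h (g x) = x" and gh: "\<And>x. g (h x) = x"
  shows "comeager (h -` S)"
proof -
  obtain G where G: "countable G" "\<And>U. U \<in> G \<Longrightarrow> open U \<and> closure U = UNIV" "\<Inter>G \<subseteq> S"
    using assms(1) unfolding comeager_def by metis
  show ?thesis
    unfolding comeager_def
  proof (intro exI[of _ "(-`) h ` G"] conjI ballI)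
    show "countable ((-`) h ` G)" using G(1) by auto
    show "\<Inter> ((-`) h ` G) \<subseteq> h -` S" using G(3) by auto
    fix W assume "W \<in> (-`) h ` G"
    then obtain U where U: "U \<in> G" "W = h -` U" by auto
    show "open W" using U G(2) h open_vimage by blast
    show "closure W = UNIV"
      unfolding dense_iff_meets_open
    proof (intro allI impI)
      fix V :: "'b set" assume V: "open V" "V \<noteq> {}"
      have "open (g -` V)" using V g open_vimage by blast
      moreover have "g -` V \<noteq> {}" using V gh by (metis ex_in_conv vimageI)
      ultimately have "g -` V \<inter> U \<noteq> {}"
        using G(2)[OF U(1)] dense_iff_meets_open by blast
      then show "V \<inter> W \<noteq> {}" using U hg by auto
    qed
  qed
qed

text \<open>This is the Baire category theorem for compact Hausdorff spaces, in the form that later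
  yields one point with several generic properties at once.\<close>

lemma comeager_meets_open:
  fixes S :: "'b::topological_space set"
  assumes "compact (UNIV :: 'b set)" "Hausdorff_space (euclidean :: 'b topology)"
    and "comeager S" "open U" "U \<noteq> {}"
  shows "U \<inter> S \<noteq> {}"
proof -
  obtain G where G: "countable G" "\<And>U. U \<in> G \<Longrightarrow> open U \<and> closure U = UNIV" "\<Inter>G \<subseteq> S"
    using assms(3) unfolding comeager_def by metis
  have c: "compact_space (euclidean :: 'b topology)"
    using assms(1) by (simp add: compact_space_def)
  have "euclidean closure_of \<Inter>G = topspace euclidean"
    by (rule Baire_category)
      (use G c assms(2) in \<open>auto simp: compact_imp_locally_compact_space
        compact_Hausdorff_imp_regular_space\<close>)
  then have "closure (\<Inter>G) = UNIV" by simp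
  then have "U \<inter> \<Inter>G \<noteq> {}" using assms(4,5) by (simp add: dense_iff_meets_open)
  then show ?thesis using G(3) by auto
qed

section \<open>The generic limit set\<close>

lemma realm_INT: "realm f (\<Inter>i\<in>I. C i) = (\<Inter>i\<in>I. realm f (C i))"
  unfolding realm_def by auto

lemma generic_limit_set_closed: "closed (generic_limit_set f)"
  unfolding generic_limit_set_def by auto

lemma generic_limit_set_subset:
  "closed C \<Longrightarrow> comeager (realm f C) \<Longrightarrow> generic_limit_set f \<subseteq> C"
  unfolding generic_limit_set_def by auto

text \<open>If the orbit were outside \<open>Q\<close> infinitely often, sequential compactness
  would give a subsequence of these visits converging to a limit point of the orbit in the closed
  set \<open>- Q\<close>.\<close>

lemma eventually_in_open_of_omega_limit_subset:
  fixes f :: "'b::first_countable_topology \<Rightarrow> 'b"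
  assumes "compact (UNIV :: 'b set)" "open Q" "omega_limit f x \<subseteq> Q"
  shows "\<forall>\<^sub>F t in sequentially. (f ^^ t) x \<in> Q"
proof (rule ccontr)
  assume "\<not> ?thesis"
  then have "\<exists>\<^sub>F t in sequentially. (f ^^ t) x \<notin> Q"
    by (simp add: not_eventually)
  then have inf: "infinite {t. (f ^^ t) x \<notin> Q}"
    by (simp add: frequently_cofinite flip: cofinite_eq_sequentially)
  define r where "r = enumerate {t. (f ^^ t) x \<notin> Q}"
  have r: "strict_mono r" "\<And>k. (f ^^ r k) x \<in> - Q"
    using inf strict_mono_enumerate enumerate_in_set[OF inf] by (auto simp: r_def)
  have "seq_compact (UNIV :: 'b set)" using assms(1) compact_imp_seq_compact by blast
  then obtain l s where s: "strict_mono s" "((\<lambda>k. (f ^^ r k) x) \<circ> s) \<longlonglongrightarrow> l"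
    unfolding seq_compact_def by (metis UNIV_I)
  have "l \<in> - Q"
    by (rule Lim_in_closed_set[OF _ _ _ s(2)]) (use assms(2) r in auto)
  moreover have "l \<in> omega_limit f x"
    unfolding omega_limit_def using s r(1)
    by (auto intro!: exI[of _ "r \<circ> s"] strict_mono_o simp: o_def)
  ultimately show False using assms(3) by auto
qed

text \<open>The complements of the closed sets that define the generic limit set cover the compact
  set \<open>- Q\<close>, so finitely many suffice. The intersection of the corresponding finitely
  many closed sets lies in \<open>Q\<close> and still has a comeager realm.\<close>

lemma comeager_eventually_near_generic_limit_set:
  fixes f :: "'b::first_countable_topology \<Rightarrow> 'b"
  assumes "compact (UNIV :: 'b set)" "open Q" "generic_limit_set f \<subseteq> Q"
  shows "comeager {x. \<forall>\<^sub>F t in sequentially. (f ^^ t) x \<in> Q}"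
proof -
  define \<C> where "\<C> = {C. closed C \<and> comeager (realm f C)}"
  have c: "compact (- Q)" using assms(1,2) compact_Int_closed[of UNIV "- Q"] by auto
  have cover: "- Q \<subseteq> (\<Union>C\<in>\<C>. - C)"
    using assms(3) unfolding generic_limit_set_def \<C>_def by blast
  obtain F where F: "F \<subseteq> \<C>" "finite F" "- Q \<subseteq> (\<Union>C\<in>F. - C)"
    by (rule compactE_image[OF c _ cover]) (auto simp: \<C>_def)
  have "comeager (realm f (\<Inter>C\<in>F. C))"
    unfolding realm_INT
    by (rule comeager_INT) (use F in \<open>auto simp: \<C>_def countable_finite\<close>)
  moreover have "realm f (\<Inter>C\<in>F. C) \<subseteq> {x. \<forall>\<^sub>F t in sequentially. (f ^^ t) x \<in> Q}"
  proof
    fix x assume "x \<in> realm f (\<Inter>C\<in>F. C)"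
    then have "omega_limit f x \<subseteq> (\<Inter>C\<in>F. C)" by (simp add: realm_def)
    also have "\<dots> \<subseteq> Q" using F(3) by auto
    finally show "x \<in> {x. \<forall>\<^sub>F t in sequentially. (f ^^ t) x \<in> Q}"
      using eventually_in_open_of_omega_limit_subset[OF assms(1,2)] by simp
  qed
  ultimately show ?thesis using comeager_mono by blast
qed

lemma continuous_on_funpow:
  fixes f :: "'b::topological_space \<Rightarrow> 'b"
  shows "continuous_on UNIV f \<Longrightarrow> continuous_on UNIV (f ^^ t)"
proof (induction t)
  case 0
  then show ?case by (simp add: id_def)
next
  case (Suc t)
  then show ?case
    using continuous_on_compose[of UNIV "f ^^ t" f] continuous_on_subset[of UNIV f] by simp
qed

text \<open>
  The set \<open>U\<close> plays the role of an enabling word: if there were none for \<open>D\<close>, the points that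
  eventually avoid \<open>D\<close> would contain a dense open set, so the complement of \<open>D\<close> would contain
  the generic limit set.
\<close>
lemma comeager_frequently_in_open:
  fixes f :: "'b::topological_space \<Rightarrow> 'b"
  assumes f: "continuous_on UNIV f" and D: "open D" "D \<inter> generic_limit_set f \<noteq> {}"
  obtains U where "open U" "U \<noteq> {}"
    "comeager {x. x \<in> U \<longrightarrow> (\<exists>\<^sub>F t in sequentially. (f ^^ t) x \<in> D)}"
proof -
  define W where "W T = (\<Union>t\<in>{T..}. (f ^^ t) -` D)" for T :: nat
  have W: "open (W T)" for T
    unfolding W_def using D(1) continuous_on_funpow[OF f] by (auto intro: open_vimage)
  have "\<exists>U. open U \<and> U \<noteq> {} \<and> (\<forall>T. U \<subseteq> closure (W T))"
  proof (rule ccontr)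
    assume *: "\<not> ?thesis"
    define O' where "O' = (\<Union>T. - closure (W T))"
    have "closure O' = UNIV"
      unfolding dense_iff_meets_open
    proof (intro allI impI)
      fix U :: "'b set" assume "open U" "U \<noteq> {}"
      then show "U \<inter> O' \<noteq> {}" using * unfolding O'_def by blast
    qed
    then have "comeager O'"
      by (intro comeager_open_dense) (auto simp: O'_def)
    moreover have "O' \<subseteq> realm f (- D)"
    proof
      fix x assume "x \<in> O'"
      then obtain T where "x \<notin> W T" unfolding O'_def using closure_subset by blast
      then have T: "(f ^^ t) x \<notin> D" if "t \<ge> T" for t using that by (auto simp: W_def)
      have "y \<in> - D" if y: "y \<in> omega_limit f x" for y
      proof -
        obtain r where r: "strict_mono r" "(\<lambda>k. (f ^^ r k) x) \<longlonglongrightarrow> y"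
          using y unfolding omega_limit_def by auto
        have "eventually (\<lambda>k. (f ^^ r k) x \<in> - D) sequentially"
          unfolding eventually_sequentially
          using T seq_suble[OF r(1)] by (metis ComplI order_trans)
        then show ?thesis
          using r D(1) by (intro Lim_in_closed_set[OF _ _ _ r(2)]) auto
      qed
      then show "x \<in> realm f (- D)" unfolding realm_def by auto
    qed
    ultimately have "comeager (realm f (- D))" using comeager_mono by blast
    then have "generic_limit_set f \<subseteq> - D" using D(1) generic_limit_set_subset by blast
    then show False using D(2) by auto
  qed
  then obtain U where U: "open U" "U \<noteq> {}" "\<And>T. U \<subseteq> closure (W T)" by blast
  \<comment> \<open>Each \<open>W T\<close> is dense in \<open>U\<close> only; adding the exterior
    of \<open>U\<close> makes it dense everywhere and changes nothing inside \<open>U\<close>. Lying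
    in every \<open>W T\<close> means visiting \<open>D\<close> infinitely often.\<close>
  have "comeager (\<Inter>T\<in>UNIV. W T \<union> - closure U)"
  proof (rule comeager_INT)
    fix T
    have "closure U \<subseteq> closure (W T)" using U(3) by (simp add: closure_minimal)
    then have "closure (W T \<union> - closure U) = UNIV"
      unfolding closure_Un using closure_subset[of "- closure U"] by blast
    then show "comeager (W T \<union> - closure U)" using W by (intro comeager_open_dense) auto
  qed auto
  moreover have "(\<Inter>T\<in>UNIV. W T \<union> - closure U)
      \<subseteq> {x. x \<in> U \<longrightarrow> (\<exists>\<^sub>F t in sequentially. (f ^^ t) x \<in> D)}"
    using closure_subset[of U] by (auto simp: W_def frequently_sequentially)
  ultimately show ?thesis using that U comeager_mono by blast
qed

text \<open>A homeomorphism commuting with \<open>f\<close> carries limit points of orbits to limit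
  points. So the preimage under \<open>h\<close> of a closed set with comeager realm is again such a
  set, hence contains \<open>x\<close>. With \<open>h\<close> a power of the shift this gives shift
  invariance.\<close>

lemma generic_limit_set_homeomorphism:
  fixes f h g :: "'b::topological_space \<Rightarrow> 'b"
  assumes h: "continuous_on UNIV h" and g: "continuous_on UNIV g"
    and hg: "\<And>x. h (g x) = x" and gh: "\<And>x. g (h x) = x"
    and hf: "\<And>x. h (f x) = f (h x)"
    and x: "x \<in> generic_limit_set f"
  shows "h x \<in> generic_limit_set f"
proof -
  have pow: "h ((f ^^ t) y) = (f ^^ t) (h y)" for t y
    by (induction t) (simp_all add: hf)
  have omega: "h y \<in> omega_limit f (h x)" if y: "y \<in> omega_limit f x" for x y
  proof -
    obtain r where r: "strict_mono r" "(\<lambda>k. (f ^^ r k) x) \<longlonglongrightarrow> y"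
      using y unfolding omega_limit_def by auto
    have "(\<lambda>k. h ((f ^^ r k) x)) \<longlonglongrightarrow> h y"
      using continuous_on_tendsto_compose[OF h r(2)] by simp
    then show ?thesis using r(1) unfolding omega_limit_def pow by blast
  qed
  have "h x \<in> C" if C: "closed C" "comeager (realm f C)" for C
  proof -
    have "h -` realm f C \<subseteq> realm f (h -` C)"
      unfolding realm_def using omega by blast
    with comeager_vimage[OF C(2) h g hg gh] have "comeager (realm f (h -` C))"
      by (rule comeager_mono)
    with closed_vimage[OF C(1) h] have "generic_limit_set f \<subseteq> h -` C"
      by (rule generic_limit_set_subset)
    then show ?thesis using x by blast
  qed
  then show ?thesis unfolding generic_limit_set_def by auto
qed

section \<open>The full shift\<close>

text \<open>The singleton of a point is a neighbourhood base. The configuration space, a countable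
  product, thereby becomes first countable, as the argument with convergent subsequences
  requires.\<close>

instance discrete_topology < first_countable_topology
proof
  fix x :: 'a
  show "\<exists>A::nat \<Rightarrow> 'a set.
      (\<forall>i. x \<in> A i \<and> open (A i)) \<and> (\<forall>S. open S \<and> x \<in> S \<longrightarrow> (\<exists>i. A i \<subseteq> S))"
    by (rule exI[of _ "\<lambda>_. {x}"]) (auto simp: open_discrete)
qed

text \<open>Basic open sets of the product restrict finitely many cells, and these fit into a
  central window. Openness thus becomes a statement about windows \<open>[-M, M]\<close>.\<close>

lemma open_config_iff:
  fixes U :: "'a::discrete_topology config set"
  shows "open U \<longleftrightarrow> (\<forall>x\<in>U. \<exists>M. \<forall>y. (\<forall>i. \<bar>i\<bar> \<le> M \<longrightarrow> y i = x i) \<longrightarrow> y \<in> U)"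
proof (intro iffI ballI)
  fix x assume "open U" "x \<in> U"
  then obtain V where V: "x \<in> Pi\<^sub>E UNIV V" "finite {i. V i \<noteq> UNIV}" "Pi\<^sub>E UNIV V \<subseteq> U"
    using product_topology_open_contains_basis[of "\<lambda>_. euclidean" UNIV U x]
    unfolding open_fun_def by auto
  obtain M where M: "\<And>i. V i \<noteq> UNIV \<Longrightarrow> \<bar>i\<bar> \<le> M"
    using finite_imageI[OF V(2), of abs] bdd_above_finite[of "abs ` {i. V i \<noteq> UNIV}"]
    unfolding bdd_above_def by auto
  have "y \<in> U" if "\<forall>i. \<bar>i\<bar> \<le> M \<longrightarrow> y i = x i" for y
  proof -
    have "y i \<in> V i" for i
      using that M[of i] V(1) by (cases "V i = UNIV") (auto simp: PiE_iff)
    then show ?thesis using V(3) by (auto simp: PiE_iff)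
  qed
  then show "\<exists>M. \<forall>y. (\<forall>i. \<bar>i\<bar> \<le> M \<longrightarrow> y i = x i) \<longrightarrow> y \<in> U" by blast
next
  assume *: "\<forall>x\<in>U. \<exists>M. \<forall>y. (\<forall>i. \<bar>i\<bar> \<le> M \<longrightarrow> y i = x i) \<longrightarrow> y \<in> U"
  show "open U"
  proof (rule Topological_Spaces.openI)
    fix x assume "x \<in> U"
    then obtain M where M: "\<forall>y. (\<forall>i. \<bar>i\<bar> \<le> M \<longrightarrow> y i = x i) \<longrightarrow> y \<in> U" using * by blast
    define V where "V i = (if \<bar>i\<bar> \<le> M then {x i} else UNIV)" for i
    have "{i. V i \<noteq> UNIV} \<subseteq> {-M..M}" by (auto simp: V_def)
    then have "open (Pi\<^sub>E UNIV V)"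
      by (intro open_PiE) (auto simp: open_discrete intro: finite_subset)
    moreover have "x \<in> Pi\<^sub>E UNIV V" by (auto simp: V_def)
    moreover have "Pi\<^sub>E UNIV V \<subseteq> U"
    proof
      fix y assume "y \<in> Pi\<^sub>E UNIV V"
      then have "y i \<in> V i" for i by auto
      then have "y i = x i" if "\<bar>i\<bar> \<le> M" for i using that by (metis V_def singletonD)
      then show "y \<in> U" using M by blast
    qed
    ultimately show "\<exists>T. open T \<and> x \<in> T \<and> T \<subseteq> U" by blast
  qed
qed

lemma euclidean_config:
  "(euclidean :: 'a::{finite,discrete_topology} config topology)
    = product_topology (\<lambda>_. euclidean) UNIV"
  by (simp add: euclidean_product_topology)

lemma compact_config: "compact (UNIV :: 'a::{finite,discrete_topology} config set)"
proof -
  have "compact (UNIV :: 'a set)" by (simp add: finite_imp_compact)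
  then have "compact_space (euclidean :: 'a config topology)"
    unfolding euclidean_config compact_space_product_topology by (simp add: compact_space_def)
  then show ?thesis by (simp add: compact_space_def)
qed

lemma Hausdorff_config:
  "Hausdorff_space (euclidean :: 'a::{finite,discrete_topology} config topology)"
proof -
  have "Hausdorff_space (euclidean :: 'a topology)"
    unfolding Hausdorff_space_def by (simp add: disjnt_def) (metis hausdorff)
  then show ?thesis
    unfolding euclidean_config Hausdorff_space_product_topology by simp
qed

lemma continuous_on_shift_power:
  "continuous_on UNIV (shift_power m :: 'a::topological_space config \<Rightarrow> 'a config)"
  by (rule continuous_on_coordinatewise_then_product) (simp add: shift_power_apply)

lemma shift_power_add: "shift_power m (shift_power n x) = shift_power (m + n) x"
  by (rule ext) (simp add: shift_power_apply algebra_simps)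

lemma shift_power_0 [simp]: "shift_power 0 x = x"
  by (rule ext) (simp add: shift_power_apply)

lemma shift_eq_shift_power: "shift = shift_power 1"
  by (intro ext) (simp add: shift_power_apply shift_def)

lemma shift_power_commute:
  assumes "f \<circ> shift = shift \<circ> f"
  shows "shift_power m (f x) = f (shift_power m x)"
proof -
  have pos: "shift_power 1 (f x) = f (shift_power 1 x)" for x
    using assms by (metis comp_apply shift_eq_shift_power)
  \<comment> \<open>Commutation with the inverse follows by applying the inverse shift to
    \<open>pos\<close> at the point \<open>shift_power (-1) x\<close>.\<close>
  have neg: "shift_power (-1) (f x) = f (shift_power (-1) x)" for x
    using arg_cong[OF pos[of "shift_power (-1) x"], of "shift_power (-1)"]
    by (simp add: shift_power_add)
  show ?thesis
  proof (induction m arbitrary: x rule: int_induct[where k = 0])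
    case (step1 i)
    have "shift_power (i + 1) (f x) = shift_power i (shift_power 1 (f x))"
      by (simp add: shift_power_add)
    then show ?case by (simp add: pos step1 shift_power_add)
  next
    case (step2 i)
    have "shift_power (i - 1) (f x) = shift_power i (shift_power (-1) (f x))"
      by (simp add: shift_power_add)
    then show ?case by (simp add: neg step2 shift_power_add)
  qed simp
qed

lemma generic_limit_set_shift_power:
  fixes f :: "'a::{finite,discrete_topology} config \<Rightarrow> 'a config"
  assumes "f \<circ> shift = shift \<circ> f" "x \<in> generic_limit_set f"
  shows "shift_power m x \<in> generic_limit_set f"
  by (rule generic_limit_set_homeomorphism[where g = "shift_power (- m)"])
    (use assms in \<open>simp_all add: continuous_on_shift_power shift_power_add
      shift_power_commute\<close>)

section \<open>Words and SFT approximations\<close>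

lemma length_factor_at [simp]: "length (factor_at x i n) = n"
  by (simp add: factor_at_def)

lemma factor_at_eq_iff:
  "factor_at x i n = factor_at y j n \<longleftrightarrow> (\<forall>k. 0 \<le> k \<longrightarrow> k < int n \<longrightarrow> x (i + k) = y (j + k))"
proof -
  have "factor_at x i n = factor_at y j n \<longleftrightarrow> (\<forall>k<n. x (i + int k) = y (j + int k))"
    by (auto simp: factor_at_def)
  also have "\<dots> \<longleftrightarrow> (\<forall>k. 0 \<le> k \<longrightarrow> k < int n \<longrightarrow> x (i + k) = y (j + k))"
    by (metis of_nat_0_le_iff of_nat_less_iff zero_le_imp_eq_int)
  finally show ?thesis .
qed

lemma factor_at_shift_power: "factor_at (shift_power m x) i n = factor_at x (i + m) n"
  unfolding factor_at_eq_iff by (simp add: shift_power_apply algebra_simps)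

lemma factor_at_append:
  "factor_at x i (m + n) = factor_at x i m @ factor_at x (i + int m) n"
  by (rule nth_equalityI) (auto simp: factor_at_def nth_append algebra_simps of_nat_diff)

text \<open>The language only records words at the origin; shift invariance moves a word from any
  position there.\<close>

lemma factor_at_in_language:
  assumes "\<And>m x. x \<in> X \<Longrightarrow> shift_power m x \<in> X" "x \<in> X"
  shows "factor_at x i n \<in> language X"
proof -
  have "shift_power i x \<in> cylinder (factor_at x i n) \<inter> X"
    using assms by (simp add: cylinder_def factor_at_shift_power)
  then show ?thesis unfolding language_def by blast
qed

lemma language_obtain:
  assumes "w \<in> language X"
  obtains x where "x \<in> X" "factor_at x 0 (length w) = w"
  using assms unfolding language_def cylinder_def by blast

lemma sft_approx_iff: "x \<in> sft_approx n X \<longleftrightarrow> (\<forall>i. factor_at x i n \<in> language X)"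
proof -
  have "x \<in> sft_approx n X
      \<longleftrightarrow> (\<forall>w. length w = n \<longrightarrow> w \<notin> language X \<longrightarrow> \<not> (\<exists>i. factor_at x i n = w))"
    unfolding sft_approx_def language_n_def occurs_in_def by auto
  also have "\<dots> \<longleftrightarrow> (\<forall>i. factor_at x i n \<in> language X)"
    by (metis length_factor_at)
  finally show ?thesis .
qed

lemma sft_approx_shift_power: "x \<in> sft_approx n X \<Longrightarrow> shift_power m x \<in> sft_approx n X"
  by (simp add: sft_approx_iff factor_at_shift_power)

lemma subshiftI:
  assumes "closed X" "\<And>m x. x \<in> X \<Longrightarrow> shift_power m x \<in> X"
  shows "subshift X"
proof -
  have "x \<in> shift ` X" if "x \<in> X" for x
  proof (rule image_eqI)
    show "x = shift (shift_power (-1) x)"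
      by (simp add: shift_eq_shift_power shift_power_add)
  qed (use that assms(2) in blast)
  then show ?thesis
    unfolding subshift_def using assms by (auto simp: shift_eq_shift_power)
qed

lemma closed_sft_approx:
  fixes X :: "'a::{finite,discrete_topology} config set"
  shows "closed (sft_approx n X)"
proof -
  have "open (- sft_approx n X)"
    unfolding open_config_iff
  proof
    fix x assume "x \<in> - sft_approx n X"
    then obtain i where i: "factor_at x i n \<notin> language X" by (auto simp: sft_approx_iff)
    have "y \<in> - sft_approx n X" if "\<forall>j. \<bar>j\<bar> \<le> \<bar>i\<bar> + int n \<longrightarrow> y j = x j" for y
    proof -
      have "factor_at y i n = factor_at x i n"
        unfolding factor_at_eq_iff using that by auto
      then show ?thesis using i sft_approx_iff by (metis ComplI)
    qed
    then show "\<exists>M. \<forall>y. (\<forall>i. \<bar>i\<bar> \<le> M \<longrightarrow> y i = x i) \<longrightarrow> y \<in> - sft_approx n X" by blast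
  qed
  then show ?thesis by (simp add: closed_def)
qed

lemma subshift_sft_approx:
  fixes X :: "'a::{finite,discrete_topology} config set"
  shows "subshift (sft_approx n X)"
  using closed_sft_approx sft_approx_shift_power by (rule subshiftI)

text \<open>Two points that share a word of length \<open>n\<close> are joined along it. The two
  halves overlap in \<open>n\<close> cells, so every window of length \<open>n\<close> lies entirely
  in one half and no forbidden word arises.\<close>

lemma sft_approx_glue:
  assumes z: "z \<in> sft_approx n X" and z': "z' \<in> sft_approx n X"
    and eq: "factor_at z i n = factor_at z' i' n"
  obtains y where "y \<in> sft_approx n X" "\<And>l. l < i + int n \<Longrightarrow> y l = z l"
    "\<And>l. i \<le> l \<Longrightarrow> y l = z' (l - i + i')"
proof
  define y where "y l = (if l < i + int n then z l else z' (l - i + i'))" for l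
  show left: "y l = z l" if "l < i + int n" for l using that by (simp add: y_def)
  have zz: "z l = z' (l - i + i')" if "i \<le> l" "l < i + int n" for l
    using that eq[unfolded factor_at_eq_iff, rule_format, of "l - i"] by (simp add: algebra_simps)
  show right: "y l = z' (l - i + i')" if "i \<le> l" for l
    using that zz by (simp add: y_def)
  have "factor_at y j n \<in> language X" for j
  proof (cases "j \<le> i")
    case True
    then have "factor_at y j n = factor_at z j n" unfolding factor_at_eq_iff by (simp add: left)
    then show ?thesis using z by (simp add: sft_approx_iff)
  next
    case False
    then have "factor_at y j n = factor_at z' (j - i + i') n"
      unfolding factor_at_eq_iff by (simp add: right algebra_simps)
    then show ?thesis using z' by (simp add: sft_approx_iff)
  qed
  then show "y \<in> sft_approx n X" by (simp add: sft_approx_iff)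
qed

text \<open>This is reachability from \<open>a\<close> to \<open>b\<close> along a point of
  \<open>Y\<close>. Occurrences may overlap or coincide, since one time step may move a word by
  fewer than \<open>n\<close> cells or not at all.\<close>

definition leads_to :: "'a config set \<Rightarrow> nat \<Rightarrow> 'a list \<Rightarrow> 'a list \<Rightarrow> bool" where
  "leads_to Y n a b \<longleftrightarrow>
     (\<exists>z\<in>Y. \<exists>i j. i \<le> j \<and> factor_at z i n = a \<and> factor_at z j n = b)"

lemma leads_to_trans:
  assumes "leads_to (sft_approx n X) n a b" "leads_to (sft_approx n X) n b c"
  shows "leads_to (sft_approx n X) n a c"
proof -
  obtain z i j where z: "z \<in> sft_approx n X" "i \<le> j" "factor_at z i n = a" "factor_at z j n = b"
    using assms(1) unfolding leads_to_def by blast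
  obtain z' i' j' where z': "z' \<in> sft_approx n X" "i' \<le> j'" "factor_at z' i' n = b"
      "factor_at z' j' n = c"
    using assms(2) unfolding leads_to_def by blast
  obtain y where y: "y \<in> sft_approx n X" "\<And>l. l < j + int n \<Longrightarrow> y l = z l"
    "\<And>l. j \<le> l \<Longrightarrow> y l = z' (l - j + i')"
    using sft_approx_glue[OF z(1) z'(1), of j i'] z z' by metis
  have "factor_at y i n = a"
    unfolding z(3)[symmetric] factor_at_eq_iff using z(2) by (simp add: y(2))
  moreover have "factor_at y (j' - i' + j) n = c"
    unfolding z'(4)[symmetric] factor_at_eq_iff using z'(2) by (simp add: y(3) algebra_simps)
  ultimately show ?thesis
    unfolding leads_to_def using y(1) z(2) z'(2)
    by (intro bexI[of _ y] exI[of _ i] exI[of _ "j' - i' + j"]) auto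
qed

text \<open>Words of arbitrary length reduce to words of length \<open>n\<close>: \<open>u\<close>
  is followed by some block \<open>a\<close>, \<open>v\<close> is preceded by some block
  \<open>b\<close>, and a point leading from \<open>a\<close> to \<open>b\<close> is glued in
  between.\<close>

lemma transitive_sft_approxI:
  fixes X :: "'a::{finite,discrete_topology} config set"
  assumes conn: "\<And>a b. a \<in> language_n n X \<Longrightarrow> b \<in> language_n n X
    \<Longrightarrow> leads_to (sft_approx n X) n a b"
  shows "transitive_subshift (sft_approx n X)"
  unfolding transitive_subshift_def
proof (intro conjI ballI)
  show "subshift (sft_approx n X)" by (rule subshift_sft_approx)
  fix u v assume "u \<in> language (sft_approx n X)" "v \<in> language (sft_approx n X)"
  then obtain p q where p: "p \<in> sft_approx n X" "factor_at p 0 (length u) = u"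
    and q: "q \<in> sft_approx n X" "factor_at q 0 (length v) = v"
    by (metis language_obtain)
  \<comment> \<open>The blocks are taken next to the words: \<open>a\<close> starts right after
    \<open>u\<close> in \<open>p\<close>, and \<open>b\<close> ends right before \<open>v\<close> at
    the origin of \<open>q\<close>.\<close>
  define a where "a = factor_at p (int (length u)) n"
  define b where "b = factor_at q (- int n) n"
  have "a \<in> language_n n X" "b \<in> language_n n X"
    using p q by (auto simp: a_def b_def language_n_def sft_approx_iff)
  then obtain z i j where z: "z \<in> sft_approx n X" "i \<le> j" "factor_at z i n = a"
      "factor_at z j n = b"
    using conn unfolding leads_to_def by blast
  obtain y where y: "y \<in> sft_approx n X" "\<And>l. l < int (length u) + int n \<Longrightarrow> y l = p l"
    "\<And>l. int (length u) \<le> l \<Longrightarrow> y l = z (l - int (length u) + i)"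
    using sft_approx_glue[OF p(1) z(1), of "int (length u)" i] z(3) a_def by metis
  \<comment> \<open>This is where the block \<open>b\<close> starts after the first gluing, so
    \<open>v\<close> will start at \<open>k + int n\<close>.\<close>
  define k where "k = int (length u) + (j - i)"
  have "factor_at y k n = b"
    unfolding z(4)[symmetric] factor_at_eq_iff k_def using z(2) by (simp add: y(3) algebra_simps)
  then obtain x where x: "x \<in> sft_approx n X" "\<And>l. l < k + int n \<Longrightarrow> x l = y l"
    "\<And>l. k \<le> l \<Longrightarrow> x l = q (l - k - int n)"
    using sft_approx_glue[OF y(1) q(1), of k "- int n"] b_def by (metis add_uminus_conv_diff)
  define w where "w = factor_at x (int (length u)) (nat (j - i) + n)"
  have "factor_at x 0 (length u) = u"
    by (subst (2) p(2)[symmetric], unfold factor_at_eq_iff)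
      (use z(2) in \<open>simp add: x(2) y(2) k_def\<close>)
  moreover have "factor_at x (k + int n) (length v) = v"
    by (subst (2) q(2)[symmetric], unfold factor_at_eq_iff) (simp add: x(3))
  moreover have "int (length u) + int (nat (j - i) + n) = k + int n"
    using z(2) by (simp add: k_def)
  ultimately have "factor_at x 0 (length u + (nat (j - i) + n + length v)) = u @ w @ v"
    by (simp only: factor_at_append w_def add_0)
  then have "u @ w @ v \<in> language (sft_approx n X)"
    using factor_at_in_language[OF sft_approx_shift_power x(1)] by metis
  then show "\<exists>w. u @ w @ v \<in> language (sft_approx n X)" by blast
qed

section \<open>Chain transitivity\<close>

lemma open_sets_meet_after_shift:
  fixes U V :: "'a::discrete_topology config set"
  assumes "open U" "U \<noteq> {}" "open V" "V \<noteq> {}"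
  obtains m where "m \<ge> 0" "U \<inter> shift_power m -` V \<noteq> {}"
proof -
  obtain x M where x: "\<And>y. (\<forall>i. \<bar>i\<bar> \<le> M \<longrightarrow> y i = x i) \<Longrightarrow> y \<in> U"
    using assms(1,2) unfolding open_config_iff by blast
  obtain x' M' where x': "\<And>y. (\<forall>i. \<bar>i\<bar> \<le> M' \<longrightarrow> y i = x' i) \<Longrightarrow> y \<in> V"
    using assms(3,4) unfolding open_config_iff by blast
  \<comment> \<open>Far enough that the window of radius \<open>M'\<close> around cell
    \<open>m\<close> lies to the right of cell \<open>M\<close>; the absolute values keep
    \<open>m\<close> nonnegative whatever the signs of the radii.\<close>
  define m where "m = \<bar>M\<bar> + \<bar>M'\<bar> + 1"
  define y where "y i = (if i \<le> M then x i else x' (i - m))" for i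
  have "y \<in> U" by (rule x) (auto simp: y_def)
  moreover have "shift_power m y \<in> V"
    by (rule x') (auto simp: y_def m_def shift_power_apply)
  ultimately show ?thesis using that[of m] by (auto simp: m_def)
qed

text \<open>
  Applied to the central words \<open>c t\<close> along an orbit. They move by \<open>k\<close> cells per step inside a
  window that looks like the generic limit set, so they are linked forwards in time if
  \<open>k \<ge> 0\<close> and backwards otherwise.
\<close>
lemma linked_along_sequence:
  fixes c :: "nat \<Rightarrow> 'a list" and k :: int
  assumes trans: "\<And>a b d. R a b \<Longrightarrow> R b d \<Longrightarrow> R a d"
    and refl: "\<And>t. T \<le> t \<Longrightarrow> R (c t) (c t)"
    and step: "\<And>t. T \<le> t \<Longrightarrow> if k \<ge> 0 then R (c t) (c (Suc t)) else R (c (Suc t)) (c t)"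
    and fr: "\<exists>\<^sub>F t in sequentially. P t" "\<exists>\<^sub>F t in sequentially. Q t"
  shows "\<exists>s t. T \<le> t \<and> P s \<and> Q t \<and> R (c s) (c t)"
proof -
  have up: "R (c s) (c t)" if "k \<ge> 0" "T \<le> s" "s \<le> t" for s t
    using that(3)
  proof (induction rule: dec_induct)
    case (step t)
    then show ?case using assms(3)[of t] trans that by auto
  qed (use refl that in auto)
  have down: "R (c t) (c s)" if "\<not> k \<ge> 0" "T \<le> s" "s \<le> t" for s t
    using that(3)
  proof (induction rule: dec_induct)
    case (step t)
    then show ?case using assms(3)[of t] trans that by auto
  qed (use refl that in auto)
  show ?thesis
  proof (cases "k \<ge> 0")
    case True
    \<comment> \<open>Links run forwards in time, so the time for \<open>P\<close> is fixed first
      and a later one is chosen for \<open>Q\<close>; in the other case the order of choice is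
      reversed.\<close>
    obtain s where s: "T \<le> s" "P s" using fr(1) by (auto simp: frequently_sequentially)
    obtain t where t: "s \<le> t" "Q t" using fr(2) by (auto simp: frequently_sequentially)
    show ?thesis using s t up[OF True s(1) t(1)] order_trans by blast
  next
    case False
    obtain t where t: "T \<le> t" "Q t" using fr(2) by (auto simp: frequently_sequentially)
    obtain s where s: "t \<le> s" "P s" using fr(1) by (auto simp: frequently_sequentially)
    show ?thesis using s t down[OF False t(1) s(1)] by blast
  qed
qed

lemma language_n_leads_to:
  fixes f :: "'a::{finite,discrete_topology} config \<Rightarrow> 'a config"
  defines "X \<equiv> generic_limit_set f"
  assumes f: "continuous_on UNIV f" "f \<circ> shift = shift \<circ> f"
    and k: "\<And>x. x \<in> X \<Longrightarrow> f x = shift_power k x"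
    and a: "a \<in> language_n n X" and b: "b \<in> language_n n X"
  shows "leads_to (sft_approx n X) n a b"
proof -
  have inv: "shift_power m x \<in> X" if "x \<in> X" for m x
    using that generic_limit_set_shift_power[OF f(2)] by (simp add: X_def)
  have openf: "open {x :: 'a config. factor_at x 0 n = w}" for w
    unfolding open_config_iff
  proof (intro ballI exI allI impI)
    fix x y :: "'a config"
    assume "x \<in> {x. factor_at x 0 n = w}" "\<forall>i. \<bar>i\<bar> \<le> int n \<longrightarrow> y i = x i"
    moreover from this have "factor_at y 0 n = factor_at x 0 n"
      unfolding factor_at_eq_iff by simp
    ultimately show "y \<in> {x. factor_at x 0 n = w}" by simp
  qed
  have enabling: "\<exists>U. open U \<and> U \<noteq> {} \<and>
      comeager {x. x \<in> U \<longrightarrow> (\<exists>\<^sub>F t in sequentially. factor_at ((f ^^ t) x) 0 n = w)}"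
    if w: "w \<in> language_n n X" for w
  proof -
    have "{x. factor_at x 0 n = w} \<inter> generic_limit_set f \<noteq> {}"
      using w by (auto simp: language_n_def language_def cylinder_def X_def)
    from comeager_frequently_in_open[OF f(1) openf this] show ?thesis by auto
  qed
  obtain U where U: "open U" "U \<noteq> {}"
      "comeager {x. x \<in> U \<longrightarrow> (\<exists>\<^sub>F t in sequentially. factor_at ((f ^^ t) x) 0 n = a)}"
    using enabling[OF a] by blast
  obtain V where V: "open V" "V \<noteq> {}"
      "comeager {x. x \<in> V \<longrightarrow> (\<exists>\<^sub>F t in sequentially. factor_at ((f ^^ t) x) 0 n = b)}"
      (is "comeager ?SV")
    using enabling[OF b] by blast
  obtain m where m: "m \<ge> 0" "U \<inter> shift_power m -` V \<noteq> {}"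
    using open_sets_meet_after_shift U V by metis
  \<comment> \<open>The window \<open>[-M, M]\<close> contains all blocks of length \<open>n\<close>
    starting between \<open>-\<bar>k\<bar>\<close> and \<open>\<bar>k\<bar> + m\<close>: those at
    \<open>0\<close>, \<open>k\<close> and \<open>m\<close> are compared below.\<close>
  define M where "M = int n + \<bar>k\<bar> + m"
  \<comment> \<open>A neighbourhood of \<open>X\<close> with two properties: the central window
    agrees with a point of \<open>X\<close>, and \<open>f\<close> brings the block at
    \<open>k\<close> to the origin. The union over \<open>w\<close> writes the equality of the two
    blocks as a visibly open condition.\<close>
  define Q where "Q = (\<Union>z\<in>X. {y. \<forall>i. \<bar>i\<bar> \<le> M \<longrightarrow> y i = z i})
      \<inter> (\<Union>w. {y. factor_at y k n = w} \<inter> {y. factor_at (f y) 0 n = w})"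
  have "open (\<Union>z\<in>X. {y. \<forall>i. \<bar>i\<bar> \<le> M \<longrightarrow> y i = z i})"
    unfolding open_config_iff by (intro ballI exI[of _ M]) auto
  moreover have "open (\<Union>w. {y. factor_at y k n = w} \<inter> {y. factor_at (f y) 0 n = w})" (is "open (\<Union>w. ?E w)")
  proof (intro open_UN ballI)
    fix w :: "'a list"
    have "{y. factor_at y k n = w} = shift_power k -` {x. factor_at x 0 n = w}"
      by (auto simp: factor_at_shift_power)
    moreover have "{y. factor_at (f y) 0 n = w} = f -` {x. factor_at x 0 n = w}" by auto
    ultimately show "open (?E w)"
      using open_vimage[OF openf f(1)] open_vimage[OF openf continuous_on_shift_power] by auto
  qed
  ultimately have "open Q" unfolding Q_def by (rule open_Int)
  moreover have "X \<subseteq> Q"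
    unfolding Q_def by (auto simp: k factor_at_shift_power)
  ultimately have near: "comeager {x. \<forall>\<^sub>F t in sequentially. (f ^^ t) x \<in> Q}"
    unfolding X_def by (rule comeager_eventually_near_generic_limit_set[OF compact_config])
  \<comment> \<open>The genericity wanted for \<open>b\<close> concerns the shifted point
    \<open>shift_power m x\<close>; pulling it back makes it a condition on
    \<open>x\<close>.\<close>
  have "comeager (shift_power m -` ?SV)"
    by (rule comeager_vimage[OF V(3), where g = "shift_power (- m)"])
      (simp_all add: continuous_on_shift_power shift_power_add)
  moreover have "open (U \<inter> shift_power m -` V)"
    using U V continuous_on_shift_power open_vimage by blast
  ultimately obtain x where x: "x \<in> U" "shift_power m x \<in> V"
      "x \<in> {x. x \<in> U \<longrightarrow> (\<exists>\<^sub>F t in sequentially. factor_at ((f ^^ t) x) 0 n = a)}"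
      "shift_power m x \<in> ?SV" "\<forall>\<^sub>F t in sequentially. (f ^^ t) x \<in> Q"
    using comeager_meets_open[OF compact_config Hausdorff_config
        comeager_Int[OF comeager_Int[OF U(3) near]], of "shift_power m -` ?SV"
        "U \<inter> shift_power m -` V"] m(2)
    by blast
  \<comment> \<open>Thus a visit of the shifted orbit to \<open>b\<close> at the origin is an
    occurrence of \<open>b\<close> at \<open>m\<close> in the orbit of \<open>x\<close>.\<close>
  have pow: "(f ^^ t) (shift_power m x) = shift_power m ((f ^^ t) x)" for t
    by (induction t) (simp_all add: shift_power_commute[OF f(2)])
  obtain T where T: "\<And>t. t \<ge> T \<Longrightarrow> (f ^^ t) x \<in> Q"
    using x(5) by (auto simp: eventually_sequentially)
  have window: "leads_to (sft_approx n X) n (factor_at ((f ^^ t) x) i n) (factor_at ((f ^^ t) x) j n)"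
    if t: "T \<le> t" and ij: "-\<bar>k\<bar> \<le> i" "i \<le> j" "j \<le> \<bar>k\<bar> + m" for t i j
  proof -
    obtain z where z: "z \<in> X" "\<forall>i. \<bar>i\<bar> \<le> M \<longrightarrow> (f ^^ t) x i = z i"
      using T[OF t] by (auto simp: Q_def)
    have "factor_at ((f ^^ t) x) l n = factor_at z l n" if "-\<bar>k\<bar> \<le> l" "l \<le> \<bar>k\<bar> + m" for l
      unfolding factor_at_eq_iff using that z(2) m(1) by (auto simp: M_def)
    moreover have "z \<in> sft_approx n X"
      using z(1) factor_at_in_language[OF inv] by (auto simp: sft_approx_iff)
    ultimately show ?thesis
      unfolding leads_to_def using ij m(1)
      by (intro bexI[of _ z] exI[of _ i] exI[of _ j]) auto
  qed
  define c where "c t = factor_at ((f ^^ t) x) 0 n" for t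
  have c_Suc: "c (Suc t) = factor_at ((f ^^ t) x) k n" if "T \<le> t" for t
    using T[OF that] by (auto simp: c_def Q_def)
  \<comment> \<open>Both words are visible at time \<open>t\<close>, at cells \<open>0\<close> and
    \<open>k\<close>. The sign of \<open>k\<close> decides which is on the left.\<close>
  have step: "if k \<ge> 0 then leads_to (sft_approx n X) n (c t) (c (Suc t))
      else leads_to (sft_approx n X) n (c (Suc t)) (c t)" if "T \<le> t" for t
    using window[OF that, of 0 k] window[OF that, of k 0] m(1) c_Suc[OF that]
    by (auto simp: c_def)
  have refl: "leads_to (sft_approx n X) n (c t) (c t)" if "T \<le> t" for t
    using window[OF that, of 0 0] m(1) by (auto simp: c_def)
  have freq: "\<exists>\<^sub>F t in sequentially. c t = a"
      "\<exists>\<^sub>F t in sequentially. factor_at ((f ^^ t) x) m n = b"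
    using x by (auto simp: c_def pow factor_at_shift_power)
  have "\<exists>s t. T \<le> t \<and> c s = a \<and> factor_at ((f ^^ t) x) m n = b
      \<and> leads_to (sft_approx n X) n (c s) (c t)"
    by (rule linked_along_sequence[where T = T and k = k
        and R = "leads_to (sft_approx n X) n", OF _ _ _ freq])
      (fact leads_to_trans refl step)+
  then obtain s t where st: "T \<le> t" "c s = a" "factor_at ((f ^^ t) x) m n = b"
      "leads_to (sft_approx n X) n (c s) (c t)"
    by blast
  \<comment> \<open>At time \<open>t\<close> the word \<open>b\<close> stands at
    \<open>m \<ge> 0\<close>, in the same window as \<open>c t\<close> and not to its left. This
    link works for either sign of \<open>k\<close>, which is why the shift by \<open>m\<close> was
    arranged.\<close>
  have "leads_to (sft_approx n X) n (c t) b"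
    using window[OF st(1), of 0 m] m(1) st(3) by (auto simp: c_def)
  then show ?thesis using st leads_to_trans by metis
qed

theorem proposition5:
  fixes f :: "'a::{finite,discrete_topology} config \<Rightarrow> 'a config"
  assumes "cellular_automaton f"
    and "\<exists>n::int. \<forall>x\<in>generic_limit_set f. f x = shift_power n x"
  shows "chain_transitive_subshift (generic_limit_set f)"
proof -
  obtain k where k: "\<And>x. x \<in> generic_limit_set f \<Longrightarrow> f x = shift_power k x"
    using assms(2) by blast
  have f: "continuous_on UNIV f" "f \<circ> shift = shift \<circ> f"
    using assms(1) by (auto simp: cellular_automaton_def)
  have "subshift (generic_limit_set f)"
    using generic_limit_set_closed generic_limit_set_shift_power[OF f(2)] by (rule subshiftI)
  moreover have "transitive_subshift (sft_approx n (generic_limit_set f))" for n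
    by (rule transitive_sft_approxI) (rule language_n_leads_to[OF f k])
  ultimately show ?thesis by (simp add: chain_transitive_subshift_def)
qed

end
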